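(* Let $a>0$ and let the potential $V$ belong to the admissible class $\tilde A$. Let $\tilde D(k)$ and the Jost solution $\tilde f(y;k)$ be as defined in the context. Then $$\tilde D(k)=\frac{\tilde f(0;k)-\tilde f(0;-k)}{2ik},\qquad k\in\mathbb C,$$ where at $k=0$ the right-hand side is understood as its limit as $k\to0$. For real $k$-values, $$\operatorname{Im}[\tilde f(0;k)]=k\,\tilde D(k),\qquad k\in\mathbb R.$$
   Context: Fix $a>0$. The admissible class $\tilde A$ consists of the real-valued potentials $V(y)$, $y>0$, that vanish outside the interval $[0,a]$ and are integrable on $(0,a)$. Primes denote $y$-derivatives. For $k\in\mathbb C$ let $\tilde\phi(y;k)$ be the unique solution of $\tilde\phi''+k^2\tilde\phi=V(y)\tilde\phi$ for $y>0$ with $\tilde\phi(0;k)=0$, $\tilde\phi'(0;k)=1$, and set $$\tilde D(k):=\frac{\sin(ka)}{k}\,\tilde\phi'(a;k)-\cos(ka)\,\tilde\phi(a;k)$$ (with $\sin(ka)/k:=a$ at $k=0$). For $k\in\mathbb C$ the Jost solution $\tilde f(y;k)$ is the solution of $\tilde f''+k^2\tilde f=V(y)\tilde f$, $y>0$, satisfying $\tilde f(y;k)=e^{iky}$ and $\tilde f'(y;k)=ik\,e^{iky}$ for $y\ge a$. *)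

theory Defs
  imports "HOL-Analysis.Analysis"
begin

text \<open>
  Absolute continuity of a function on an interval \<open>S\<close>: the finite families of non-overlapping
  closed subintervals are the divisions of subsets of \<open>S\<close>, and the interval \<open>K\<close> has the endpoints
  \<open>Inf K\<close> and \<open>Sup K\<close>.
\<close>

definition absolutely_continuous_on :: "real set \<Rightarrow> (real \<Rightarrow> 'b::real_normed_vector) \<Rightarrow> bool" where
  "absolutely_continuous_on S f \<longleftrightarrow>
     (\<forall>\<epsilon>>0. \<exists>\<delta>>0. \<forall>\<D> T. \<D> division_of T \<and> T \<subseteq> S \<and> (\<Sum>K\<in>\<D>. Sup K - Inf K) < \<delta>
        \<longrightarrow> (\<Sum>K\<in>\<D>. norm (f (Sup K) - f (Inf K))) < \<epsilon>)"

text \<open>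
  Potentials and solutions live on the half-line; they are total functions on the reals whose
  values at negative arguments play no role.
\<close>

definition admissible_potential :: "real \<Rightarrow> (real \<Rightarrow> real) \<Rightarrow> bool" where
  "admissible_potential a V \<longleftrightarrow>
     (\<forall>y>0. y \<notin> {0..a} \<longrightarrow> V y = 0) \<and> V absolutely_integrable_on {0<..<a}"

text \<open>The \<open>y\<close>-derivative on the half-line (one-sided at \<open>0\<close>, two-sided at every \<open>y > 0\<close>).\<close>

definition half_line_deriv :: "(real \<Rightarrow> complex) \<Rightarrow> real \<Rightarrow> complex" where
  "half_line_deriv u y = vector_derivative u (at y within {0..})"

text \<open>
  As the potential is only integrable, \<open>u'' + k\<^sup>2 u = V u\<close> is understood in the usual
  (Caratheodory) sense: \<open>u\<close> is differentiable, \<open>u'\<close> is locally absolutely continuous, and the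
  equation holds at almost every \<open>y > 0\<close>. The closed half-line is used so that the boundary
  values \<open>u(0)\<close> and \<open>u'(0)\<close> make sense.
\<close>

definition schroedinger_solution :: "(real \<Rightarrow> real) \<Rightarrow> complex \<Rightarrow> (real \<Rightarrow> complex) \<Rightarrow> bool" where
  "schroedinger_solution V k u \<longleftrightarrow>
     (\<forall>y\<ge>0. u differentiable (at y within {0..})) \<and>
     (\<forall>b>0. absolutely_continuous_on {0..b} (half_line_deriv u)) \<and>
     (AE y in lebesgue. y > 0 \<longrightarrow>
        (\<exists>w. (half_line_deriv u has_vector_derivative w) (at y) \<and>
             w + k\<^sup>2 * u y = complex_of_real (V y) * u y))"

definition regular_solution :: "(real \<Rightarrow> real) \<Rightarrow> complex \<Rightarrow> (real \<Rightarrow> complex) \<Rightarrow> bool" where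
  "regular_solution V k \<phi> \<longleftrightarrow>
     schroedinger_solution V k \<phi> \<and> \<phi> 0 = 0 \<and> half_line_deriv \<phi> 0 = 1"

definition jost_solution :: "real \<Rightarrow> (real \<Rightarrow> real) \<Rightarrow> complex \<Rightarrow> (real \<Rightarrow> complex) \<Rightarrow> bool" where
  "jost_solution a V k f \<longleftrightarrow>
     schroedinger_solution V k f \<and>
     (\<forall>y\<ge>a. f y = exp (\<i> * k * of_real y) \<and>
             half_line_deriv f y = \<i> * k * exp (\<i> * k * of_real y))"

text \<open>The family \<open>\<phi>\<close> of regular solutions is indexed by the spectral parameter \<open>k\<close>.\<close>

definition D_tilde :: "real \<Rightarrow> (complex \<Rightarrow> real \<Rightarrow> complex) \<Rightarrow> complex \<Rightarrow> complex" where
  "D_tilde a \<phi> k =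
     (if k = 0 then of_real a else sin (k * of_real a) / k) * half_line_deriv (\<phi> k) a
     - cos (k * of_real a) * \<phi> k a"

end

theory Submission
  imports Defs
begin

text \<open>
  The Wronskian of two solutions of the same equation does not depend on \<open>y\<close>. The equation contains
  only \<open>k\<^sup>2\<close>, so the regular solution \<open>\<phi>\<close> at \<open>k\<close> may be paired with the Jost solutions \<open>f\<close> at both \<open>k\<close> and
  \<open>- k\<close>. At \<open>y = 0\<close> the Wronskian is the value of the Jost solution there, because \<open>\<phi>\<close> has the initial data
  \<open>0\<close> and \<open>1\<close>. At \<open>y = a\<close> it is \<open>exp (\<plusminus> \<i> k a) (\<phi>' \<mp> \<i> k \<phi>)\<close>. Subtracting the two signs gives
  \<open>2 \<i> k\<close> times the function \<open>D\<close> (\<open>jost_solution_difference_at_0\<close>). For real \<open>k\<close> the complex conjugate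
  of the Jost solution at \<open>k\<close> is a Jost solution at \<open>- k\<close>, and the same identity computes the
  imaginary part.

  The limit at \<open>k = 0\<close> amounts to continuity of \<open>D\<close> at \<open>0\<close>, that is, of \<open>\<phi>\<close> and its derivative at \<open>a\<close> as
  functions of \<open>k\<close>. It follows from a Gronwall estimate for the difference of two regular solutions.

  The potential is merely integrable, so that second derivatives exist only almost everywhere. Both
  the constancy of the Wronskian and the Gronwall estimate therefore rest on one fact about an
  absolutely continuous function: its increment is at most the integral of any integrable bound that
  holds for its derivative almost everywhere (\<open>absolutely_continuous_on_increment_bound\<close>). This has
  a short direct proof by tagged divisions, without differentiation of integrals.
\<close>

section \<open>Absolutely continuous functions\<close>

lemma absolutely_continuous_on_subset:
  assumes "absolutely_continuous_on S f" "T \<subseteq> S"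
  shows "absolutely_continuous_on T f"
  unfolding absolutely_continuous_on_def
proof (intro allI impI)
  fix e :: real assume "e > 0"
  then obtain \<delta> where "\<delta> > 0" and \<delta>: "\<And>\<D> U. \<D> division_of U \<Longrightarrow> U \<subseteq> S \<Longrightarrow>
      (\<Sum>K\<in>\<D>. Sup K - Inf K) < \<delta> \<Longrightarrow> (\<Sum>K\<in>\<D>. norm (f (Sup K) - f (Inf K))) < e"
    using assms(1) unfolding absolutely_continuous_on_def by meson
  with assms(2) show "\<exists>\<delta>>0. \<forall>\<D> U. \<D> division_of U \<and> U \<subseteq> T \<and> (\<Sum>K\<in>\<D>. Sup K - Inf K) < \<delta> \<longrightarrow>
      (\<Sum>K\<in>\<D>. norm (f (Sup K) - f (Inf K))) < e"
    by (meson order_trans)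
qed

lemma division_of_Sup_Inf_mem:
  fixes K :: "real set"
  assumes "\<D> division_of T" "K \<in> \<D>"
  shows "Sup K \<in> T" "Inf K \<in> T"
proof -
  obtain u v where K: "K = {u..v}"
    using division_ofD(4)[OF assms] by auto
  moreover have "K \<noteq> {}" "K \<subseteq> T"
    using division_ofD(2,3)[OF assms] by auto
  ultimately show "Sup K \<in> T" "Inf K \<in> T"
    by auto
qed

text \<open>
  Sums, products with bounded factors, pairs, conjugates and Lipschitz images all inherit absolute
  continuity for the same reason, that their increments are dominated by those of the components.
\<close>

lemma absolutely_continuous_on_dominated:
  fixes A B :: real
  assumes f: "absolutely_continuous_on S f" and g: "absolutely_continuous_on S g"
    and dom: "\<And>x y. x \<in> S \<Longrightarrow> y \<in> S \<Longrightarrow>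
      norm (h y - h x) \<le> A * norm (f y - f x) + B * norm (g y - g x)"
  shows "absolutely_continuous_on S h"
  unfolding absolutely_continuous_on_def
proof (intro allI impI)
  fix e :: real assume "e > 0"
  define M where "M = 1 + \<bar>A\<bar> + \<bar>B\<bar>"
  have M: "M > 0" "A \<le> M" "B \<le> M" by (auto simp: M_def)
  define e' where "e' = e / (2 * M)"
  have "e' > 0" using \<open>e > 0\<close> M by (simp add: e'_def)
  obtain \<delta>1 where "\<delta>1 > 0" and \<delta>1: "\<And>\<D> U. \<D> division_of U \<Longrightarrow> U \<subseteq> S \<Longrightarrow>
      (\<Sum>K\<in>\<D>. Sup K - Inf K) < \<delta>1 \<Longrightarrow> (\<Sum>K\<in>\<D>. norm (f (Sup K) - f (Inf K))) < e'"
    using f \<open>e' > 0\<close> unfolding absolutely_continuous_on_def by meson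
  obtain \<delta>2 where "\<delta>2 > 0" and \<delta>2: "\<And>\<D> U. \<D> division_of U \<Longrightarrow> U \<subseteq> S \<Longrightarrow>
      (\<Sum>K\<in>\<D>. Sup K - Inf K) < \<delta>2 \<Longrightarrow> (\<Sum>K\<in>\<D>. norm (g (Sup K) - g (Inf K))) < e'"
    using g \<open>e' > 0\<close> unfolding absolutely_continuous_on_def by meson
  show "\<exists>\<delta>>0. \<forall>\<D> T. \<D> division_of T \<and> T \<subseteq> S \<and> (\<Sum>K\<in>\<D>. Sup K - Inf K) < \<delta> \<longrightarrow>
      (\<Sum>K\<in>\<D>. norm (h (Sup K) - h (Inf K))) < e"
  proof (intro exI[of _ "min \<delta>1 \<delta>2"] conjI allI impI)
    show "min \<delta>1 \<delta>2 > 0" using \<open>\<delta>1 > 0\<close> \<open>\<delta>2 > 0\<close> by simp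
    fix \<D> T assume *: "\<D> division_of T \<and> T \<subseteq> S \<and> (\<Sum>K\<in>\<D>. Sup K - Inf K) < min \<delta>1 \<delta>2"
    let ?F = "\<Sum>K\<in>\<D>. norm (f (Sup K) - f (Inf K))"
    let ?G = "\<Sum>K\<in>\<D>. norm (g (Sup K) - g (Inf K))"
    have "(\<Sum>K\<in>\<D>. norm (h (Sup K) - h (Inf K)))
        \<le> (\<Sum>K\<in>\<D>. M * norm (f (Sup K) - f (Inf K)) + M * norm (g (Sup K) - g (Inf K)))"
    proof (rule sum_mono)
      fix K assume K: "K \<in> \<D>"
      have "norm (h (Sup K) - h (Inf K))
          \<le> A * norm (f (Sup K) - f (Inf K)) + B * norm (g (Sup K) - g (Inf K))"
        using * division_of_Sup_Inf_mem[OF _ K] by (intro dom) blast+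
      also have "\<dots> \<le> M * norm (f (Sup K) - f (Inf K)) + M * norm (g (Sup K) - g (Inf K))"
        by (intro add_mono mult_right_mono M norm_ge_zero)
      finally show "norm (h (Sup K) - h (Inf K))
        \<le> M * norm (f (Sup K) - f (Inf K)) + M * norm (g (Sup K) - g (Inf K))" .
    qed
    also have "\<dots> = M * (?F + ?G)"
      by (simp add: sum.distrib sum_distrib_left distrib_left)
    also have "\<dots> < M * (e' + e')"
      using * \<delta>1[of \<D> T] \<delta>2[of \<D> T] M by (intro mult_strict_left_mono add_strict_mono) auto
    also have "\<dots> = e" using M by (simp add: e'_def)
    finally show "(\<Sum>K\<in>\<D>. norm (h (Sup K) - h (Inf K))) < e" .
  qed
qed

lemma absolutely_continuous_on_ident: "absolutely_continuous_on S (\<lambda>x::real. x)"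
proof -
  have "(\<Sum>K\<in>\<D>. norm (Sup K - Inf K)) = (\<Sum>K\<in>\<D>. Sup K - Inf K)"
    if div: "\<D> division_of T" for \<D> and T :: "real set"
  proof (rule sum.cong[OF refl])
    fix K assume K: "K \<in> \<D>"
    obtain u v where "K = {u..v}" "u \<le> v"
      using division_ofD(3)[OF div K] division_ofD(4)[OF div K]
      by (metis atLeastatMost_empty_iff2 box_real(2))
    then show "norm (Sup K - Inf K) = Sup K - Inf K" by simp
  qed
  then show ?thesis
    unfolding absolutely_continuous_on_def by metis
qed

lemma absolutely_continuous_on_imp_continuous_on:
  fixes f :: "real \<Rightarrow> 'b::real_normed_vector"
  assumes "absolutely_continuous_on {c..d} f"
  shows "continuous_on {c..d} f"
  unfolding continuous_on_iff
proof (intro ballI allI impI)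
  fix x e :: real assume x: "x \<in> {c..d}" and "e > 0"
  then obtain \<delta> where "\<delta> > 0" and \<delta>: "\<And>\<D> U. \<D> division_of U \<Longrightarrow> U \<subseteq> {c..d} \<Longrightarrow>
      (\<Sum>K\<in>\<D>. Sup K - Inf K) < \<delta> \<Longrightarrow> (\<Sum>K\<in>\<D>. norm (f (Sup K) - f (Inf K))) < e"
    using assms unfolding absolutely_continuous_on_def by meson
  have inc: "norm (f v - f u) < e" if "u \<in> {c..d}" "v \<in> {c..d}" "u \<le> v" "v - u < \<delta>" for u v
    using \<delta>[of "{{u..v}}" "{u..v}"] that division_of_self[of u v] by auto
  show "\<exists>\<delta>>0. \<forall>y\<in>{c..d}. dist y x < \<delta> \<longrightarrow> dist (f y) (f x) < e"
  proof (intro exI[of _ \<delta>] conjI ballI impI \<open>\<delta> > 0\<close>)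
    fix y assume y: "y \<in> {c..d}" "dist y x < \<delta>"
    show "dist (f y) (f x) < e"
    proof (cases "x \<le> y")
      case True
      then show ?thesis using inc[OF x y(1)] y(2) by (simp add: dist_norm)
    next
      case False
      then show ?thesis using inc[OF y(1) x] y(2) by (simp add: dist_norm norm_minus_commute)
    qed
  qed
qed

text \<open>
  The increment estimate that replaces the fundamental theorem of calculus. By Cousin's lemma there
  is a tagged division adapted to a gauge of our choice. Intervals tagged outside \<open>N\<close> are so short
  that differentiability at the tag bounds the increment by a term of a Riemann sum for \<open>h\<close>;
  intervals tagged in \<open>N\<close> lie in an open set of small measure, so that absolute continuity makes
  their joint contribution small.
\<close>

lemma absolutely_continuous_on_increment_bound:
  fixes g g' :: "real \<Rightarrow> 'b::real_normed_vector" and h :: "real \<Rightarrow> real"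
  assumes ac: "absolutely_continuous_on {c..d} g" and "c \<le> d" and neg: "negligible N"
    and der: "\<And>x. x \<in> {c..d} - N \<Longrightarrow> (g has_vector_derivative g' x) (at x within {c..d})"
    and bound: "\<And>x. x \<in> {c..d} - N \<Longrightarrow> norm (g' x) \<le> h x"
    and int: "h integrable_on {c..d}"
  shows "norm (g d - g c) \<le> integral {c..d} h"
proof -
  define h0 where "h0 x = (if x \<in> N then 0 else h x)" for x
  have h0: "(h0 has_integral integral {c..d} h) {c..d}"
    using integrable_integral[OF int] by (rule has_integral_spike[OF neg, rotated]) (simp add: h0_def)
  have h0_nonneg: "h0 x \<ge> 0" if "x \<in> {c..d}" for x
    using that order_trans[OF norm_ge_zero bound[of x]] by (auto simp: h0_def)
  have est: "norm (g d - g c) \<le> integral {c..d} h + e * (2 + (d - c))" if "e > 0" for e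
  proof -
    obtain \<delta> where "\<delta> > 0" and \<delta>: "\<And>\<D> U. \<D> division_of U \<Longrightarrow> U \<subseteq> {c..d} \<Longrightarrow>
        (\<Sum>K\<in>\<D>. Sup K - Inf K) < \<delta> \<Longrightarrow> (\<Sum>K\<in>\<D>. norm (g (Sup K) - g (Inf K))) < e"
      using ac \<open>e > 0\<close> unfolding absolutely_continuous_on_def by meson
    have N: "N \<in> null_sets lebesgue" using neg by (simp add: negligible_iff_null_sets)
    then obtain G where G: "open G" "N \<subseteq> G" "G - N \<in> lmeasurable" "emeasure lebesgue (G - N) < ennreal \<delta>"
      using sets_lebesgue_outer_open[of N \<delta>] \<open>\<delta> > 0\<close> by auto
    have "emeasure lebesgue G = emeasure lebesgue (G - N)"
      using emeasure_Diff_null_set[OF N, of G] G(1) by simp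
    then have "G \<in> lmeasurable" and G_small: "measure lebesgue G < \<delta>"
      using G \<open>\<delta> > 0\<close>
      by (auto simp: fmeasurable_def measure_def enn2real_less_iff less_top intro: order.strict_trans)
    have "\<exists>\<rho>>0. \<forall>y\<in>{c..d}. \<bar>y - x\<bar> < \<rho> \<longrightarrow>
        norm (g y - g x - (y - x) *\<^sub>R g' x) \<le> e * \<bar>y - x\<bar>" if "x \<in> {c..d} - N" for x
      using der[OF that] \<open>e > 0\<close>
      unfolding has_vector_derivative_def has_derivative_within_alt by auto
    then obtain \<rho> where \<rho>: "\<And>x. x \<in> {c..d} - N \<Longrightarrow> \<rho> x > 0"
      "\<And>x y. x \<in> {c..d} - N \<Longrightarrow> y \<in> {c..d} \<Longrightarrow> \<bar>y - x\<bar> < \<rho> x \<Longrightarrow>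
        norm (g y - g x - (y - x) *\<^sub>R g' x) \<le> e * \<bar>y - x\<bar>"
      by metis
    obtain \<gamma>1 where "gauge \<gamma>1" and \<gamma>1: "\<And>\<D>. \<D> tagged_division_of {c..d} \<Longrightarrow> \<gamma>1 fine \<D> \<Longrightarrow>
        norm ((\<Sum>(x,K)\<in>\<D>. measure lborel K *\<^sub>R h0 x) - integral {c..d} h) < e"
      using h0 \<open>e > 0\<close> unfolding has_integral_real by meson
    define \<gamma>2 where "\<gamma>2 x = (if x \<in> N then G else ball x (if x \<in> {c..d} then \<rho> x else 1))" for x
    have "gauge \<gamma>2"
      using G \<rho>(1) by (auto simp: gauge_def \<gamma>2_def)
    obtain p where p: "p tagged_division_of {c..d}" and fine: "\<gamma>1 fine p" "\<gamma>2 fine p"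
      using fine_division_exists_real[OF gauge_Int[OF \<open>gauge \<gamma>1\<close> \<open>gauge \<gamma>2\<close>]]
      by (metis fine_Int)
    have "finite p" using p by blast
    \<comment> \<open>Absolute continuity controls the intervals in \<open>p1\<close>, the derivative bound the others.\<close>
    define p1 where "p1 = {(x,K) \<in> p. x \<in> N}"
    have p1: "p1 \<subseteq> p" by (auto simp: p1_def)
    \<comment> \<open>The supremum of the empty set is unspecified, so the empty interval is given weight zero by hand.\<close>
    define W where "W K = (if K = {} then 0 else norm (g (Sup K) - g (Inf K)))" for K
    have interval: "\<exists>u v. K = {u..v} \<and> u \<le> x \<and> x \<le> v \<and> c \<le> u \<and> v \<le> d" if xK: "(x,K) \<in> p" for x K
    proof -
      obtain u v where "K = {u..v}" using tagged_division_ofD(4)[OF p xK] by auto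
      then show ?thesis
        using tagged_division_ofD(2,3)[OF p xK] by auto
    qed
    have "norm (g d - g c) = norm (\<Sum>(x,K)\<in>p. g (Sup K) - g (Inf K))"
      using additive_tagged_division_1[OF \<open>c \<le> d\<close> p, of g] by simp
    also have "\<dots> \<le> (\<Sum>(x,K)\<in>p. W K)"
    proof (rule sum_norm_le, clarify)
      fix x K assume "(x,K) \<in> p"
      then show "norm (g (Sup K) - g (Inf K)) \<le> W K"
        using tagged_division_ofD(2)[OF p] by (auto simp: W_def)
    qed
    also have "\<dots> = (\<Sum>(x,K)\<in>p - p1. W K) + (\<Sum>(x,K)\<in>p1. W K)"
      by (rule sum.subset_diff[OF p1 \<open>finite p\<close>])
    also have "(\<Sum>(x,K)\<in>p1. W K) < e"
    proof -
      define \<D> where "\<D> = snd ` p1"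
      have t: "p1 tagged_division_of \<Union>\<D>"
        unfolding \<D>_def using p p1 tagged_division_of_def
        by (metis tagged_partial_division_of_Union_self tagged_partial_division_subset)
      have div: "\<D> division_of \<Union>\<D>"
        using division_of_tagged_division[OF t] by (simp add: \<D>_def)
      have sub: "\<Union>\<D> \<subseteq> {c..d}"
        using interval p1 by (fastforce simp: \<D>_def)
      have "\<Union>\<D> \<subseteq> G"
        using fine(2) by (fastforce simp: \<D>_def p1_def fine_def \<gamma>2_def)
      have len: "Sup K - Inf K = measure lebesgue K" if "K \<in> \<D>" for K
        using that interval p1 by (fastforce simp: \<D>_def)
      have "(\<Sum>K\<in>\<D>. Sup K - Inf K) = (\<Sum>K\<in>\<D>. measure lebesgue K)"
        by (rule sum.cong[OF refl len])
      also have "\<dots> = measure lebesgue (\<Union>\<D>)"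
        by (rule content_division[OF div])
      also have "\<dots> \<le> measure lebesgue G"
        using \<open>\<Union>\<D> \<subseteq> G\<close> \<open>G \<in> lmeasurable\<close> lmeasurable_division[OF div]
        by (intro measure_mono_fmeasurable) auto
      also have "\<dots> < \<delta>" by (rule G_small)
      finally have "(\<Sum>K\<in>\<D>. norm (g (Sup K) - g (Inf K))) < e"
        by (rule \<delta>[OF div sub])
      moreover have "(\<Sum>K\<in>\<D>. W K) = (\<Sum>K\<in>\<D>. norm (g (Sup K) - g (Inf K)))"
        using division_ofD(3)[OF div] by (intro sum.cong) (auto simp: W_def)
      moreover have "(\<Sum>(x,K)\<in>p1. W K) = (\<Sum>K\<in>\<D>. W K)"
        unfolding \<D>_def
      proof (rule sum.over_tagged_division_lemma[OF t])
        fix u v :: real assume "box u v = {}"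
        then show "W (cbox u v) = 0"
          by (cases "u = v") (auto simp: W_def)
      qed
      ultimately show ?thesis by simp
    qed
    also have "(\<Sum>(x,K)\<in>p - p1. W K) \<le> (\<Sum>(x,K)\<in>p - p1. measure lborel K * (h0 x + e))"
    proof (rule sum_mono, clarify)
      fix x K assume xK: "(x,K) \<in> p" "(x,K) \<notin> p1"
      obtain u v where uv: "K = {u..v}" "u \<le> x" "x \<le> v" "c \<le> u" "v \<le> d"
        using interval[OF xK(1)] by blast
      have x: "x \<in> {c..d} - N" using xK uv by (auto simp: p1_def)
      have "K \<subseteq> \<gamma>2 x"
        using fine(2) xK(1) by (auto simp: fine_def)
      then have "K \<subseteq> ball x (\<rho> x)"
        using x by (simp add: \<gamma>2_def)
      moreover have "u \<in> K" "v \<in> K" using uv by simp_all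
      ultimately have "\<bar>u - x\<bar> < \<rho> x" "\<bar>v - x\<bar> < \<rho> x"
        by (metis dist_commute dist_real_def mem_ball subsetD)+
      moreover have "u \<in> {c..d}" "v \<in> {c..d}" "\<bar>u - x\<bar> = x - u" "\<bar>v - x\<bar> = v - x"
        using uv by simp_all
      ultimately have u: "norm (g u - g x - (u - x) *\<^sub>R g' x) \<le> e * (x - u)"
        and v: "norm (g v - g x - (v - x) *\<^sub>R g' x) \<le> e * (v - x)"
        using \<rho>(2)[OF x] by metis+
      have "g v - g u = (g v - g x - (v - x) *\<^sub>R g' x) - (g u - g x - (u - x) *\<^sub>R g' x)
          + (v - u) *\<^sub>R g' x"
        by (simp add: algebra_simps)
      also have "norm \<dots> \<le> norm (g v - g x - (v - x) *\<^sub>R g' x)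
          + norm (g u - g x - (u - x) *\<^sub>R g' x) + norm ((v - u) *\<^sub>R g' x)"
        by (intro order_trans[OF norm_triangle_ineq] add_right_mono norm_triangle_ineq4)
      also have "\<dots> \<le> e * (v - x) + e * (x - u) + (v - u) * norm (g' x)"
        using u v uv by (intro add_mono) auto
      also have "\<dots> = (v - u) * (norm (g' x) + e)"
        by (simp add: algebra_simps)
      also have "\<dots> \<le> (v - u) * (h0 x + e)"
        using bound[OF x] x uv by (intro mult_left_mono add_right_mono) (auto simp: h0_def)
      finally show "W K \<le> measure lborel K * (h0 x + e)"
        using uv by (simp add: W_def)
    qed
    also have "(\<Sum>(x,K)\<in>p - p1. measure lborel K * (h0 x + e)) \<le> (\<Sum>(x,K)\<in>p. measure lborel K * (h0 x + e))"
      using \<open>e > 0\<close> h0_nonneg tag_in_interval[OF p]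
      by (intro sum_mono2[OF \<open>finite p\<close>]) (auto simp: p1_def)
    also have "\<dots> = (\<Sum>(x,K)\<in>p. measure lborel K *\<^sub>R h0 x) + (\<Sum>(x,K)\<in>p. measure lborel K) * e"
      by (simp add: sum.distrib sum_distrib_right distrib_left case_prod_unfold)
    also have "(\<Sum>(x,K)\<in>p. measure lborel K) = d - c"
      using additive_content_tagged_division[of p c d] p \<open>c \<le> d\<close> by simp
    also have "(\<Sum>(x,K)\<in>p. measure lborel K *\<^sub>R h0 x) \<le> integral {c..d} h + e"
      using \<gamma>1[OF p fine(1)] by (simp add: abs_less_iff)
    finally show ?thesis by (simp add: algebra_simps)
  qed
  show ?thesis
  proof (rule field_le_epsilon)
    fix e :: real assume "e > 0"
    moreover have "2 + (d - c) > 0" using \<open>c \<le> d\<close> by simp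
    ultimately show "norm (g d - g c) \<le> integral {c..d} h + e"
      using est[of "e / (2 + (d - c))"] by simp
  qed
qed

corollary absolutely_continuous_on_zero_derivative:
  fixes g :: "real \<Rightarrow> 'b::real_normed_vector"
  assumes "absolutely_continuous_on {c..d} g" "c \<le> d" "negligible N"
    and "\<And>x. x \<in> {c..d} - N \<Longrightarrow> (g has_vector_derivative 0) (at x within {c..d})"
  shows "g d = g c"
  using absolutely_continuous_on_increment_bound[OF assms, of "\<lambda>_. 0"]
  by (simp add: integrable_0)

section \<open>A Gronwall estimate\<close>

text \<open>
  The constant depends only on the coefficient \<open>m\<close> and on
  the interval, which makes the estimate uniform over a family of equations. Over a step so short that \<open>m\<close> has integral at most one half, the maximum of
  \<open>norm (z t)\<close> is at most its initial value plus half of itself plus \<open>r\<close> times the length, so it at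
  most doubles, up to the \<open>r\<close>-term. Finitely many steps of the same length cover the interval,
  because the indefinite integral of \<open>m\<close> is uniformly continuous.
\<close>

lemma gronwall_bound:
  fixes m :: "real \<Rightarrow> real"
  assumes m_int: "m integrable_on {0..b}" and m_nonneg: "\<And>x. m x \<ge> 0" and "b \<ge> 0"
  obtains C where "C \<ge> 0"
    "\<And>(z :: real \<Rightarrow> 'b::real_normed_vector) z' N r.
      absolutely_continuous_on {0..b} z \<Longrightarrow> negligible N \<Longrightarrow> r \<ge> 0 \<Longrightarrow>
      (\<And>x. x \<in> {0..b} - N \<Longrightarrow> (z has_vector_derivative z' x) (at x within {0..b})) \<Longrightarrow>
      (\<And>x. x \<in> {0..b} - N \<Longrightarrow> norm (z' x) \<le> m x * norm (z x) + r) \<Longrightarrow>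
      norm (z b) \<le> C * (norm (z 0) + r)"
proof -
  have "uniformly_continuous_on {0..b} (\<lambda>x. integral {0..x} m)"
    by (intro compact_uniformly_continuous indefinite_integral_continuous_1 m_int compact_Icc)
  then obtain \<eta>' where "\<eta>' > 0" and \<eta>': "\<And>x y. x \<in> {0..b} \<Longrightarrow> y \<in> {0..b} \<Longrightarrow> \<bar>y - x\<bar> < \<eta>' \<Longrightarrow>
      \<bar>integral {0..y} m - integral {0..x} m\<bar> < 1/2"
    unfolding uniformly_continuous_on_def dist_real_def
    by (metis half_gt_zero_iff zero_less_one)
  define \<eta> where "\<eta> = \<eta>' / 2"
  have "\<eta> > 0" using \<open>\<eta>' > 0\<close> by (simp add: \<eta>_def)
  have sub_int: "m integrable_on {s..t}" if "0 \<le> s" "t \<le> b" for s t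
    using m_int that by (auto intro: integrable_on_subinterval)
  have short: "integral {s..t} m \<le> 1/2" if "0 \<le> s" "s \<le> t" "t \<le> b" "t \<le> s + \<eta>" for s t
  proof -
    have "integral {0..s} m + integral {s..t} m = integral {0..t} m"
      using that by (intro Henstock_Kurzweil_Integration.integral_combine sub_int) auto
    moreover have "\<bar>integral {0..t} m - integral {0..s} m\<bar> < 1/2"
      using that \<open>\<eta>' > 0\<close> by (intro \<eta>') (auto simp: \<eta>_def)
    ultimately show ?thesis by linarith
  qed
  \<comment> \<open>The hypotheses on \<open>z\<close> are bundled so that the induction over the steps can quantify over
    all solutions at once.\<close>
  define Q where "Q z r \<longleftrightarrow> r \<ge> 0 \<and> absolutely_continuous_on {0..b} z \<and>
      (\<exists>N z'. negligible N \<and> (\<forall>x\<in>{0..b} - N. (z has_vector_derivative z' x) (at x within {0..b}) \<and>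
        norm (z' x) \<le> m x * norm (z x) + r))" for z :: "real \<Rightarrow> 'b" and r
  have step: "norm (z t) \<le> 2 * (norm (z s) + r * b)"
    if Q: "Q z r" and st: "0 \<le> s" "s \<le> t" "t \<le> b" "t \<le> s + \<eta>" for z r s t
  proof -
    from Q obtain N z' where "r \<ge> 0" and ac: "absolutely_continuous_on {0..b} z" and "negligible N"
      and der: "\<And>x. x \<in> {0..b} - N \<Longrightarrow> (z has_vector_derivative z' x) (at x within {0..b})"
      and bound: "\<And>x. x \<in> {0..b} - N \<Longrightarrow> norm (z' x) \<le> m x * norm (z x) + r"
      unfolding Q_def by metis
    have "continuous_on {s..t} (\<lambda>x. norm (z x))"
      using absolutely_continuous_on_imp_continuous_on[OF ac] st
      by (intro continuous_on_norm) (auto elim: continuous_on_subset)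
    then obtain y where y: "y \<in> {s..t}" and max: "\<And>x. x \<in> {s..t} \<Longrightarrow> norm (z x) \<le> norm (z y)"
      using continuous_attains_sup[of "{s..t}" "\<lambda>x. norm (z x)"] st by auto
    have sub: "{s..y} \<subseteq> {0..b}" using y st by auto
    have m_sy: "m integrable_on {s..y}" using sub_int[of s y] y st by auto
    have "norm (z y - z s) \<le> integral {s..y} (\<lambda>x. m x * norm (z y) + r)"
    proof (rule absolutely_continuous_on_increment_bound)
      show "absolutely_continuous_on {s..y} z"
        using ac sub by (rule absolutely_continuous_on_subset)
      show "s \<le> y" "negligible N" using y \<open>negligible N\<close> by auto
      fix x assume x: "x \<in> {s..y} - N"
      then show "(z has_vector_derivative z' x) (at x within {s..y})"
        using der[of x] sub by (meson DiffD1 DiffD2 DiffI has_vector_derivative_within_subset subsetD)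
      have "norm (z' x) \<le> m x * norm (z x) + r"
        using bound[of x] x sub by auto
      also have "\<dots> \<le> m x * norm (z y) + r"
        using max[of x] x y by (intro add_right_mono mult_left_mono m_nonneg) auto
      finally show "norm (z' x) \<le> m x * norm (z y) + r" .
    next
      show "(\<lambda>x. m x * norm (z y) + r) integrable_on {s..y}"
        using m_sy by (intro integrable_add integrable_on_mult_left) auto
    qed
    also have "\<dots> = integral {s..y} m * norm (z y) + r * (y - s)"
      using m_sy y by (subst integral_add) (auto intro: integrable_on_mult_left)
    also have "\<dots> \<le> 1/2 * norm (z y) + r * b"
      using short[of s y] y st \<open>r \<ge> 0\<close> by (intro add_mono mult_mono) auto
    finally have "norm (z y) \<le> norm (z s) + (1/2 * norm (z y) + r * b)"
      using norm_triangle_sub[of "z y" "z s"] by linarith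
    then have "norm (z y) \<le> 2 * (norm (z s) + r * b)" by simp
    then show ?thesis using max[of t] st by simp
  qed
  have "\<exists>C\<ge>0. \<forall>z r t. Q z r \<longrightarrow> 0 \<le> t \<longrightarrow> t \<le> b \<longrightarrow> t \<le> real n * \<eta> \<longrightarrow> norm (z t) \<le> C * (norm (z 0) + r)"
    for n :: nat
  proof (induction n)
    case 0
    have "norm (z t) \<le> 1 * (norm (z 0) + r)" if "Q z r" "0 \<le> t" "t \<le> real 0 * \<eta>" for z r t
    proof -
      have "t = 0" using that by simp
      then show ?thesis using that by (simp add: Q_def)
    qed
    then show ?case by (intro exI[of _ 1]) simp
  next
    case (Suc n)
    then obtain C where "C \<ge> 0" and C: "\<And>z r t. Q z r \<Longrightarrow> 0 \<le> t \<Longrightarrow> t \<le> b \<Longrightarrow> t \<le> real n * \<eta> \<Longrightarrow>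
        norm (z t) \<le> C * (norm (z 0) + r)"
      by metis
    have "norm (z t) \<le> 2 * (C + b) * (norm (z 0) + r)"
      if Q: "Q z r" and t: "0 \<le> t" "t \<le> b" "t \<le> real (Suc n) * \<eta>" for z r t
    proof -
      define s where "s = max 0 (t - \<eta>)"
      have s: "0 \<le> s" "s \<le> t" "s \<le> real n * \<eta>" "t \<le> s + \<eta>"
        using t \<open>\<eta> > 0\<close> by (auto simp: s_def algebra_simps)
      have "norm (z t) \<le> 2 * (norm (z s) + r * b)"
        using s t by (intro step[OF Q])
      also have "\<dots> \<le> 2 * (C * (norm (z 0) + r) + (norm (z 0) + r) * b)"
        using C[OF Q s(1) _ s(3)] s t \<open>b \<ge> 0\<close> by (intro mult_left_mono add_mono mult_right_mono) auto
      finally show ?thesis by (simp add: algebra_simps)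
    qed
    then show ?case
      using \<open>C \<ge> 0\<close> \<open>b \<ge> 0\<close> by (intro exI[of _ "2 * (C + b)"]) simp
  qed
  moreover obtain n where "b \<le> real n * \<eta>"
    using \<open>\<eta> > 0\<close> by (metis ex_less_of_nat_mult less_imp_le)
  ultimately obtain C where "C \<ge> 0" and C: "\<And>z r. Q z r \<Longrightarrow> norm (z b) \<le> C * (norm (z 0) + r)"
    using \<open>b \<ge> 0\<close> by (metis order_refl)
  show thesis
  proof (rule that[OF \<open>C \<ge> 0\<close>])
    fix z :: "real \<Rightarrow> 'b" and z' N r
    assume "absolutely_continuous_on {0..b} z" "negligible N" "r \<ge> 0"
      and "\<And>x. x \<in> {0..b} - N \<Longrightarrow> (z has_vector_derivative z' x) (at x within {0..b})"
      and "\<And>x. x \<in> {0..b} - N \<Longrightarrow> norm (z' x) \<le> m x * norm (z x) + r"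
    then show "norm (z b) \<le> C * (norm (z 0) + r)"
      unfolding Q_def by (intro C[unfolded Q_def] conjI exI[of _ N] exI[of _ z'] ballI) auto
  qed
qed

section \<open>Solutions of the Schroedinger equation\<close>

lemma half_line_derivI:
  assumes "(u has_vector_derivative w) (at y within {0..})" "y \<ge> 0"
  shows "half_line_deriv u y = w"
proof -
  have "at y within {0..} \<noteq> bot"
    using \<open>y \<ge> 0\<close> at_le[of "{y<..}" "{0..}" y] trivial_limit_at_right_real[of y]
    by (metis atLeast_iff bot_unique greaterThan_iff less_imp_le order_trans subsetI)
  then show ?thesis
    unfolding half_line_deriv_def using assms(1) by (simp add: vector_derivative_within)
qed

lemma schroedinger_solution_deriv:
  assumes "schroedinger_solution V k u" "y \<ge> 0"
  shows "(u has_vector_derivative half_line_deriv u y) (at y within {0..})"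
  unfolding half_line_deriv_def
  by (rule iffD1[OF vector_derivative_works]) (use assms in \<open>simp add: schroedinger_solution_def\<close>)

lemma schroedinger_solution_deriv_interval:
  assumes "schroedinger_solution V k u" "y \<in> {0..b}"
  shows "(u has_vector_derivative half_line_deriv u y) (at y within {0..b})"
  by (rule has_vector_derivative_within_subset[OF schroedinger_solution_deriv[OF assms(1)]])
    (use assms(2) in auto)

lemma schroedinger_solution_continuous:
  assumes "schroedinger_solution V k u"
  shows "continuous_on {0..b} u"
  using has_vector_derivative_continuous[OF schroedinger_solution_deriv_interval[OF assms]]
  by (simp add: continuous_on_eq_continuous_within)

lemma schroedinger_solution_deriv_ac:
  assumes "schroedinger_solution V k u" "b > 0"
  shows "absolutely_continuous_on {0..b} (half_line_deriv u)"
  using assms by (simp add: schroedinger_solution_def)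

lemma schroedinger_solution_deriv_continuous:
  assumes "schroedinger_solution V k u" "b > 0"
  shows "continuous_on {0..b} (half_line_deriv u)"
  by (intro absolutely_continuous_on_imp_continuous_on schroedinger_solution_deriv_ac[OF assms])

lemma continuous_on_Icc_norm_bounded:
  fixes f :: "real \<Rightarrow> 'b::real_normed_vector"
  assumes "continuous_on {c..d} f"
  obtains B where "B \<ge> 0" "\<And>x. x \<in> {c..d} \<Longrightarrow> norm (f x) \<le> B"
proof -
  have "bounded (f ` {c..d})"
    using assms by (intro compact_imp_bounded compact_continuous_image) auto
  then obtain B where "\<forall>x\<in>f ` {c..d}. norm x \<le> B"
    unfolding bounded_iff by blast
  then show thesis
    by (intro that[of "max B 0"]) (auto intro: max.coboundedI1)
qed

text \<open>A solution is continuously differentiable, hence Lipschitz on bounded intervals.\<close>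

lemma schroedinger_solution_ac:
  assumes sol: "schroedinger_solution V k u" and "b > 0"
  shows "absolutely_continuous_on {0..b} u"
proof -
  obtain B where B: "\<And>x. x \<in> {0..b} \<Longrightarrow> norm (half_line_deriv u x) \<le> B"
    using continuous_on_Icc_norm_bounded[OF schroedinger_solution_deriv_continuous[OF assms]] by metis
  have "norm (u y - u x) \<le> B * norm (y - x) + 0 * norm (y - x)" if "x \<in> {0..b}" "y \<in> {0..b}" for x y
  proof -
    have "norm (u y - u x) \<le> B * norm (y - x)"
    proof (rule differentiable_bound)
      fix t assume t: "t \<in> {0..b}"
      show "(u has_derivative (\<lambda>h. h *\<^sub>R half_line_deriv u t)) (at t within {0..b})"
        using schroedinger_solution_deriv_interval[OF sol t] by (simp add: has_vector_derivative_def)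
      show "onorm (\<lambda>h. h *\<^sub>R half_line_deriv u t) \<le> B"
        by (intro onorm_le) (use mult_right_mono[OF B[OF t] abs_ge_zero] in \<open>simp add: mult.commute\<close>)
    qed (use that in auto)
    then show ?thesis by simp
  qed
  then show ?thesis
    by (rule absolutely_continuous_on_dominated[OF absolutely_continuous_on_ident absolutely_continuous_on_ident])
qed

lemma schroedinger_solution_second_deriv:
  assumes "schroedinger_solution V k u"
  obtains N where "negligible N" "\<And>y. y \<in> {0..b} - N \<Longrightarrow>
    (half_line_deriv u has_vector_derivative (of_real (V y) - k\<^sup>2) * u y) (at y within {0..b})"
proof -
  have "AE y in lebesgue. y > 0 \<longrightarrow> (half_line_deriv u has_vector_derivative (of_real (V y) - k\<^sup>2) * u y) (at y)"
  proof -
    have "AE y in lebesgue. y > 0 \<longrightarrow> (\<exists>w. (half_line_deriv u has_vector_derivative w) (at y) \<and>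
        w + k\<^sup>2 * u y = complex_of_real (V y) * u y)"
      using assms by (simp add: schroedinger_solution_def)
    then show ?thesis
      by eventually_elim (metis add_implies_diff left_diff_distrib)
  qed
  then obtain N where "N \<in> null_sets lebesgue" and N: "\<And>y. y > 0 \<Longrightarrow> y \<notin> N \<Longrightarrow>
      (half_line_deriv u has_vector_derivative (of_real (V y) - k\<^sup>2) * u y) (at y)"
    unfolding eventually_ae_filter by auto
  show thesis
  \<comment> \<open>The endpoint joins the exceptional set, as the equation is imposed at positive \<open>y\<close> only.\<close>
  proof (rule that[of "insert 0 N"])
    show "negligible (insert 0 N)"
      using \<open>N \<in> null_sets lebesgue\<close> by (simp add: negligible_iff_null_sets)
    show "(half_line_deriv u has_vector_derivative (of_real (V y) - k\<^sup>2) * u y) (at y within {0..b})"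
      if "y \<in> {0..b} - insert 0 N" for y
      using that by (auto intro: has_vector_derivative_at_within[OF N])
  qed
qed

lemma schroedinger_solution_minus [simp]:
  "schroedinger_solution V (- k) u \<longleftrightarrow> schroedinger_solution V k u"
  by (simp add: schroedinger_solution_def)

lemma half_line_deriv_cnj:
  assumes "schroedinger_solution V k u" "y \<ge> 0"
  shows "half_line_deriv (\<lambda>y. cnj (u y)) y = cnj (half_line_deriv u y)"
  using assms by (intro half_line_derivI has_vector_derivative_cnj schroedinger_solution_deriv)

lemma schroedinger_solution_cnj:
  assumes sol: "schroedinger_solution V k u"
  shows "schroedinger_solution V (cnj k) (\<lambda>y. cnj (u y))"
  unfolding schroedinger_solution_def
proof (intro conjI allI impI)
  fix y :: real assume "y \<ge> 0"
  then show "(\<lambda>y. cnj (u y)) differentiable (at y within {0..})"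
    using has_vector_derivative_cnj[OF schroedinger_solution_deriv[OF sol]] differentiableI_vector
    by blast
next
  fix b :: real assume "b > 0"
  show "absolutely_continuous_on {0..b} (half_line_deriv (\<lambda>y. cnj (u y)))"
  proof (rule absolutely_continuous_on_dominated[of _ _ "half_line_deriv u" _ 1 0])
    fix x y assume "x \<in> {0..b}" "y \<in> {0..b}"
    then show "norm (half_line_deriv (\<lambda>y. cnj (u y)) y - half_line_deriv (\<lambda>y. cnj (u y)) x)
        \<le> 1 * norm (half_line_deriv u y - half_line_deriv u x)
          + 0 * norm (half_line_deriv u y - half_line_deriv u x)"
      by (simp add: half_line_deriv_cnj[OF sol] flip: complex_cnj_diff)
  qed (rule schroedinger_solution_deriv_ac[OF sol \<open>b > 0\<close>])+
next
  have "AE y in lebesgue. y > 0 \<longrightarrow> (\<exists>w. (half_line_deriv u has_vector_derivative w) (at y) \<and>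
      w + k\<^sup>2 * u y = complex_of_real (V y) * u y)"
    using sol by (simp add: schroedinger_solution_def)
  then show "AE y in lebesgue. y > 0 \<longrightarrow>
      (\<exists>w. (half_line_deriv (\<lambda>y. cnj (u y)) has_vector_derivative w) (at y) \<and>
        w + (cnj k)\<^sup>2 * cnj (u y) = complex_of_real (V y) * cnj (u y))"
  proof eventually_elim
    case (elim y)
    show ?case
    proof
      assume "y > 0"
      then obtain w where w: "(half_line_deriv u has_vector_derivative w) (at y)"
        and eq: "w + k\<^sup>2 * u y = complex_of_real (V y) * u y"
        using elim by blast
      have "(half_line_deriv (\<lambda>y. cnj (u y)) has_vector_derivative cnj w) (at y)"
        by (rule has_vector_derivative_transform_within_open[OF has_vector_derivative_cnj[OF w],
              where S = "{0<..}"]) (use \<open>y > 0\<close> in \<open>auto simp: half_line_deriv_cnj[OF sol]\<close>)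
      moreover have "cnj w + (cnj k)\<^sup>2 * cnj (u y) = complex_of_real (V y) * cnj (u y)"
        using arg_cong[OF eq, of cnj] by simp
      ultimately show "\<exists>w. (half_line_deriv (\<lambda>y. cnj (u y)) has_vector_derivative w) (at y) \<and>
          w + (cnj k)\<^sup>2 * cnj (u y) = complex_of_real (V y) * cnj (u y)"
        by blast
    qed
  qed
qed

lemma absolutely_continuous_on_mult:
  fixes f g :: "real \<Rightarrow> complex"
  assumes f: "absolutely_continuous_on {c..d} f" and g: "absolutely_continuous_on {c..d} g"
  shows "absolutely_continuous_on {c..d} (\<lambda>x. f x * g x)"
proof -
  obtain F where F: "\<And>x. x \<in> {c..d} \<Longrightarrow> norm (f x) \<le> F"
    using continuous_on_Icc_norm_bounded[OF absolutely_continuous_on_imp_continuous_on[OF f]] by metis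
  obtain G where G: "\<And>x. x \<in> {c..d} \<Longrightarrow> norm (g x) \<le> G"
    using continuous_on_Icc_norm_bounded[OF absolutely_continuous_on_imp_continuous_on[OF g]] by metis
  show ?thesis
  proof (rule absolutely_continuous_on_dominated[OF f g])
    fix x y assume xy: "x \<in> {c..d}" "y \<in> {c..d}"
    have "f y * g y - f x * g x = g y * (f y - f x) + f x * (g y - g x)"
      by (simp add: algebra_simps)
    also have "norm \<dots> \<le> G * norm (f y - f x) + F * norm (g y - g x)"
      by (intro norm_triangle_le add_mono) (auto simp: norm_mult intro!: mult_right_mono F G xy)
    finally show "norm (f y * g y - f x * g x) \<le> G * norm (f y - f x) + F * norm (g y - g x)" .
  qed
qed

definition wronskian :: "(real \<Rightarrow> complex) \<Rightarrow> (real \<Rightarrow> complex) \<Rightarrow> real \<Rightarrow> complex" where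
  "wronskian u v y = u y * half_line_deriv v y - half_line_deriv u y * v y"

text \<open>
  The derivative of the Wronskian vanishes almost everywhere by the equation; absolute continuity
  is what turns this into constancy.
\<close>

lemma wronskian_constant:
  assumes u: "schroedinger_solution V k u" and v: "schroedinger_solution V k v" and "b > 0"
  shows "wronskian u v b = wronskian u v 0"
proof -
  let ?u = "half_line_deriv u" and ?v = "half_line_deriv v"
  obtain N where "negligible N" and N: "\<And>y. y \<in> {0..b} - N \<Longrightarrow>
      (?u has_vector_derivative (of_real (V y) - k\<^sup>2) * u y) (at y within {0..b})"
    using schroedinger_solution_second_deriv[OF u] by metis
  obtain M where "negligible M" and M: "\<And>y. y \<in> {0..b} - M \<Longrightarrow>
      (?v has_vector_derivative (of_real (V y) - k\<^sup>2) * v y) (at y within {0..b})"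
    using schroedinger_solution_second_deriv[OF v] by metis
  show ?thesis
  proof (rule absolutely_continuous_on_zero_derivative)
    have "absolutely_continuous_on {0..b} (\<lambda>y. u y * ?v y)"
      and "absolutely_continuous_on {0..b} (\<lambda>y. ?u y * v y)"
      using schroedinger_solution_ac[OF u \<open>b > 0\<close>] schroedinger_solution_deriv_ac[OF u \<open>b > 0\<close>]
        schroedinger_solution_ac[OF v \<open>b > 0\<close>] schroedinger_solution_deriv_ac[OF v \<open>b > 0\<close>]
      by (auto intro: absolutely_continuous_on_mult)
    then show "absolutely_continuous_on {0..b} (wronskian u v)"
    proof (rule absolutely_continuous_on_dominated[where A = 1 and B = 1])
      show "norm (wronskian u v y - wronskian u v x)
        \<le> 1 * norm (u y * ?v y - u x * ?v x) + 1 * norm (?u y * v y - ?u x * v x)" for x y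
        using norm_triangle_ineq4[of "u y * ?v y - u x * ?v x" "?u y * v y - ?u x * v x"]
        by (simp add: wronskian_def algebra_simps)
    qed
    show "0 \<le> b" "negligible (N \<union> M)"
      using \<open>b > 0\<close> \<open>negligible N\<close> \<open>negligible M\<close> by auto
    fix y assume y: "y \<in> {0..b} - (N \<union> M)"
    have "((\<lambda>y. u y * ?v y - ?u y * v y) has_vector_derivative
        (u y * ((of_real (V y) - k\<^sup>2) * v y) + ?u y * ?v y)
        - (?u y * ?v y + ((of_real (V y) - k\<^sup>2) * u y) * v y)) (at y within {0..b})"
      using y N M schroedinger_solution_deriv_interval[OF u, of y b]
        schroedinger_solution_deriv_interval[OF v, of y b]
      by (intro has_vector_derivative_diff has_vector_derivative_mult) auto
    then show "(wronskian u v has_vector_derivative 0) (at y within {0..b})"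
      by (simp add: wronskian_def[abs_def] algebra_simps)
  qed
qed

section \<open>Dependence of the regular solution on the spectral parameter\<close>

text \<open>
  The difference of the regular solutions at \<open>k\<close> and at \<open>0\<close> has vanishing initial data and solves the
  equation at \<open>k\<close> with the inhomogeneity \<open>- k\<^sup>2 \<phi>(y;0)\<close>. Gronwall's estimate for the pair of the
  difference and its derivative bounds both by a multiple of \<open>norm k ^ 2\<close>, uniformly for \<open>norm k \<le> 1\<close>.
\<close>

lemma regular_solution_tendsto_at_0:
  assumes "a > 0" and adm: "admissible_potential a V" and reg: "\<And>k. regular_solution V k (\<phi> k)"
  shows "((\<lambda>k. \<phi> k a) \<longlongrightarrow> \<phi> 0 a) (at 0)"
    and "((\<lambda>k. half_line_deriv (\<phi> k) a) \<longlongrightarrow> half_line_deriv (\<phi> 0) a) (at 0)"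
proof -
  have sol: "schroedinger_solution V k (\<phi> k)" for k
    using reg by (simp add: regular_solution_def)
  define z where "z k y = (\<phi> k y - \<phi> 0 y, half_line_deriv (\<phi> k) y - half_line_deriv (\<phi> 0) y)" for k y
  \<comment> \<open>One unit in \<open>m\<close> accounts for the first component of the system, the other for \<open>norm k ^ 2 \<le> 1\<close>.\<close>
  define m where "m y = \<bar>V y\<bar> + 2" for y
  have "(\<lambda>y. \<bar>V y\<bar>) integrable_on {0..a}"
    using adm unfolding admissible_potential_def
    by (metis absolutely_integrable_on_Icc_iff_Ioo absolutely_integrable_on_def integrable_eq real_norm_def)
  then have "m integrable_on {0..a}"
    unfolding m_def by (intro integrable_add integrable_const_ivl)
  then obtain C where "C \<ge> 0" and C: "\<And>(w :: real \<Rightarrow> complex \<times> complex) w' N r.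
      absolutely_continuous_on {0..a} w \<Longrightarrow> negligible N \<Longrightarrow> r \<ge> 0 \<Longrightarrow>
      (\<And>x. x \<in> {0..a} - N \<Longrightarrow> (w has_vector_derivative w' x) (at x within {0..a})) \<Longrightarrow>
      (\<And>x. x \<in> {0..a} - N \<Longrightarrow> norm (w' x) \<le> m x * norm (w x) + r) \<Longrightarrow>
      norm (w a) \<le> C * (norm (w 0) + r)"
  proof (rule gronwall_bound)
    show "m x \<ge> 0" for x by (simp add: m_def)
    show "a \<ge> 0" using \<open>a > 0\<close> by simp
  qed (blast intro: that)
  obtain B where "B \<ge> 0" and B: "\<And>y. y \<in> {0..a} \<Longrightarrow> norm (\<phi> 0 y) \<le> B"
    using continuous_on_Icc_norm_bounded[OF schroedinger_solution_continuous[OF sol]] by metis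
  obtain M where "negligible M" and M: "\<And>y. y \<in> {0..a} - M \<Longrightarrow>
      (half_line_deriv (\<phi> 0) has_vector_derivative (of_real (V y) - 0\<^sup>2) * \<phi> 0 y) (at y within {0..a})"
    using schroedinger_solution_second_deriv[OF sol] by metis
  have bound: "norm (z k a) \<le> C * (norm k ^ 2 * B)" if k: "norm k \<le> 1" for k
  proof -
    obtain N where "negligible N" and N: "\<And>y. y \<in> {0..a} - N \<Longrightarrow>
        (half_line_deriv (\<phi> k) has_vector_derivative (of_real (V y) - k\<^sup>2) * \<phi> k y) (at y within {0..a})"
      using schroedinger_solution_second_deriv[OF sol] by metis
    define z' where "z' y = (half_line_deriv (\<phi> k) y - half_line_deriv (\<phi> 0) y,
        (of_real (V y) - k\<^sup>2) * (\<phi> k y - \<phi> 0 y) - k\<^sup>2 * \<phi> 0 y)" for y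
    have ac1: "absolutely_continuous_on {0..a} (\<lambda>y. \<phi> k y - \<phi> 0 y)"
    proof (rule absolutely_continuous_on_dominated[OF schroedinger_solution_ac[OF sol \<open>a > 0\<close>]
          schroedinger_solution_ac[OF sol \<open>a > 0\<close>], where A = 1 and B = 1])
      show "norm ((\<phi> k y - \<phi> 0 y) - (\<phi> k x - \<phi> 0 x)) \<le> 1 * norm (\<phi> k y - \<phi> k x) + 1 * norm (\<phi> 0 y - \<phi> 0 x)" for x y
        using norm_triangle_ineq4[of "\<phi> k y - \<phi> k x" "\<phi> 0 y - \<phi> 0 x"] by (simp add: algebra_simps)
    qed
    let ?d = "\<lambda>k. half_line_deriv (\<phi> k)"
    have ac2: "absolutely_continuous_on {0..a} (\<lambda>y. ?d k y - ?d 0 y)"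
    proof (rule absolutely_continuous_on_dominated[OF schroedinger_solution_deriv_ac[OF sol \<open>a > 0\<close>]
          schroedinger_solution_deriv_ac[OF sol \<open>a > 0\<close>], where A = 1 and B = 1])
      show "norm ((?d k y - ?d 0 y) - (?d k x - ?d 0 x)) \<le> 1 * norm (?d k y - ?d k x) + 1 * norm (?d 0 y - ?d 0 x)" for x y
        using norm_triangle_ineq4[of "?d k y - ?d k x" "?d 0 y - ?d 0 x"] by (simp add: algebra_simps)
    qed
    have "norm (z k a) \<le> C * (norm (z k 0) + norm k ^ 2 * B)"
    proof (rule C)
      show "absolutely_continuous_on {0..a} (z k)"
      proof (rule absolutely_continuous_on_dominated[OF ac1 ac2, where A = 1 and B = 1])
        show "norm (z k y - z k x) \<le> 1 * norm ((\<phi> k y - \<phi> 0 y) - (\<phi> k x - \<phi> 0 x))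
            + 1 * norm ((?d k y - ?d 0 y) - (?d k x - ?d 0 x))" for x y
          using norm_Pair_le by (simp add: z_def)
      qed
      show "negligible (N \<union> M)" using \<open>negligible N\<close> \<open>negligible M\<close> by simp
      show "norm k ^ 2 * B \<ge> 0" using \<open>B \<ge> 0\<close> by simp
      fix y assume y: "y \<in> {0..a} - (N \<union> M)"
      have "((\<lambda>y. ?d k y - ?d 0 y) has_vector_derivative
          (of_real (V y) - k\<^sup>2) * \<phi> k y - (of_real (V y) - 0\<^sup>2) * \<phi> 0 y) (at y within {0..a})"
        using y N M by (intro has_vector_derivative_diff) auto
      then have "((\<lambda>y. ?d k y - ?d 0 y) has_vector_derivative
          (of_real (V y) - k\<^sup>2) * (\<phi> k y - \<phi> 0 y) - k\<^sup>2 * \<phi> 0 y) (at y within {0..a})"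
        by (simp add: algebra_simps)
      then show "(z k has_vector_derivative z' y) (at y within {0..a})"
        unfolding z_def[abs_def] z'_def using y
        by (intro has_vector_derivative_Pair has_vector_derivative_diff[OF
            schroedinger_solution_deriv_interval[OF sol] schroedinger_solution_deriv_interval[OF sol]]) auto
      have "norm (z' y) \<le> norm (?d k y - ?d 0 y)
          + norm ((of_real (V y) - k\<^sup>2) * (\<phi> k y - \<phi> 0 y) - k\<^sup>2 * \<phi> 0 y)"
        unfolding z'_def by (rule norm_Pair_le)
      also have "norm (?d k y - ?d 0 y) \<le> norm (z k y)"
        unfolding z_def by (metis norm_snd_le snd_conv)
      also have "norm ((of_real (V y) - k\<^sup>2) * (\<phi> k y - \<phi> 0 y) - k\<^sup>2 * \<phi> 0 y)
          \<le> norm (of_real (V y) - k\<^sup>2) * norm (\<phi> k y - \<phi> 0 y) + norm k ^ 2 * norm (\<phi> 0 y)"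
        by (metis norm_mult norm_power norm_triangle_ineq4)
      also have "\<dots> \<le> (\<bar>V y\<bar> + 1) * norm (z k y) + norm k ^ 2 * B"
      proof (intro add_mono mult_mono)
        show "norm (of_real (V y) - k\<^sup>2) \<le> \<bar>V y\<bar> + 1"
          using norm_triangle_ineq4[of "of_real (V y)" "k\<^sup>2"] power_le_one[OF norm_ge_zero k, of 2]
          by (simp add: norm_power)
        show "norm (\<phi> k y - \<phi> 0 y) \<le> norm (z k y)"
          unfolding z_def by (metis fst_conv norm_fst_le)
        show "norm (\<phi> 0 y) \<le> B" using y by (intro B) auto
      qed auto
      finally show "norm (z' y) \<le> m y * norm (z k y) + norm k ^ 2 * B"
        by (simp add: m_def algebra_simps)
    qed
    also have "z k 0 = 0"
      using reg[of k] reg[of 0] by (simp add: z_def regular_solution_def zero_prod_def)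
    finally show ?thesis by simp
  qed
  have "((\<lambda>k::complex. C * (norm k ^ 2 * B)) \<longlongrightarrow> C * (norm (0::complex) ^ 2 * B)) (at 0)"
    by (intro tendsto_intros)
  then have lim: "((\<lambda>k::complex. C * (norm k ^ 2 * B)) \<longlongrightarrow> 0) (at 0)" by simp
  have "\<forall>\<^sub>F k in at 0. norm (z k a) \<le> C * (norm k ^ 2 * B)"
    unfolding eventually_at by (intro exI[of _ 1]) (auto intro!: bound)
  then have z_lim: "((\<lambda>k. z k a) \<longlongrightarrow> 0) (at 0)"
    using lim by (rule Lim_null_comparison)
  from tendsto_fst[OF z_lim] tendsto_snd[OF z_lim] show "((\<lambda>k. \<phi> k a) \<longlongrightarrow> \<phi> 0 a) (at 0)"
    and "((\<lambda>k. half_line_deriv (\<phi> k) a) \<longlongrightarrow> half_line_deriv (\<phi> 0) a) (at 0)"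
    by (simp_all add: z_def LIM_zero_iff)
qed

lemma D_tilde_tendsto_at_0:
  assumes "a > 0" "admissible_potential a V" "\<And>k. regular_solution V k (\<phi> k)"
  shows "(D_tilde a \<phi> \<longlongrightarrow> D_tilde a \<phi> 0) (at 0)"
proof -
  have "((\<lambda>k. sin (k * of_real a)) has_field_derivative of_real a) (at (0::complex))"
    by (auto intro!: derivative_eq_intros)
  then have "((\<lambda>k::complex. sin (k * of_real a) / k) \<longlongrightarrow> of_real a) (at 0)"
    by (simp add: has_field_derivative_iff)
  moreover have "((\<lambda>k::complex. cos (k * of_real a)) \<longlongrightarrow> cos (0 * of_real a)) (at 0)"
    by (intro tendsto_intros)
  ultimately have "((\<lambda>k. sin (k * of_real a) / k * half_line_deriv (\<phi> k) a - cos (k * of_real a) * \<phi> k a)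
      \<longlongrightarrow> of_real a * half_line_deriv (\<phi> 0) a - cos (0 * of_real a) * \<phi> 0 a) (at 0)"
    by (intro tendsto_diff tendsto_mult regular_solution_tendsto_at_0[OF assms])
  then have "((\<lambda>k. sin (k * of_real a) / k * half_line_deriv (\<phi> k) a - cos (k * of_real a) * \<phi> k a)
      \<longlongrightarrow> D_tilde a \<phi> 0) (at 0)"
    by (simp add: D_tilde_def)
  then show ?thesis
    by (rule tendsto_cong[THEN iffD1, rotated])
      (auto simp: D_tilde_def eventually_at intro!: exI[of _ 1])
qed

section \<open>The Jost solution at the origin\<close>

lemma regular_solution_minus [simp]: "regular_solution V (- k) \<phi> \<longleftrightarrow> regular_solution V k \<phi>"
  by (simp add: regular_solution_def)

text \<open>
  The initial data of \<open>\<phi>\<close> make \<open>f 0\<close> the Wronskian of \<open>f\<close> and \<open>\<phi>\<close> at the origin; the normalization of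
  the Jost solution gives the Wronskian at \<open>a\<close>.
\<close>

lemma jost_solution_at_0:
  assumes "a > 0" and reg: "regular_solution V k \<phi>" and jost: "jost_solution a V k f"
  shows "f 0 = exp (\<i> * k * of_real a) * (half_line_deriv \<phi> a - \<i> * k * \<phi> a)"
proof -
  have "f 0 = wronskian f \<phi> 0"
    using reg by (simp add: wronskian_def regular_solution_def)
  also have "\<dots> = wronskian f \<phi> a"
    using assms wronskian_constant[of V k f \<phi> a] by (simp add: regular_solution_def jost_solution_def)
  also have "\<dots> = exp (\<i> * k * of_real a) * (half_line_deriv \<phi> a - \<i> * k * \<phi> a)"
    using jost by (simp add: wronskian_def jost_solution_def algebra_simps)
  finally show ?thesis .
qed

text \<open>The factor \<open>k\<close> is kept on the right, so that the identity also holds at \<open>k = 0\<close>.\<close>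

lemma jost_solution_difference_at_0:
  assumes "a > 0" "regular_solution V k (\<phi> k)" "jost_solution a V k f" "jost_solution a V (- k) g"
  shows "f 0 - g 0 = 2 * \<i> * k * D_tilde a \<phi> k"
proof -
  let ?E = "exp (\<i> * (k * of_real a))" and ?E' = "exp (- (\<i> * (k * of_real a)))"
  let ?d = "half_line_deriv (\<phi> k) a"
  have f: "f 0 = ?E * (?d - \<i> * k * \<phi> k a)"
    using jost_solution_at_0[OF assms(1-3)] by (simp add: mult.assoc)
  have g: "g 0 = ?E' * (?d + \<i> * k * \<phi> k a)"
    using jost_solution_at_0[OF assms(1) _ assms(4), of "\<phi> k"] assms(2) by (simp add: mult.assoc)
  have sin: "2 * \<i> * sin (k * of_real a) = ?E - ?E'" and cos: "2 * cos (k * of_real a) = ?E + ?E'"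
    by (simp_all add: sin_exp_eq cos_exp_eq)
  have "2 * \<i> * k * D_tilde a \<phi> k
      = (2 * \<i> * sin (k * of_real a)) * ?d - \<i> * k * (2 * cos (k * of_real a)) * \<phi> k a"
    by (simp add: D_tilde_def algebra_simps)
  also have "\<dots> = f 0 - g 0"
    unfolding sin cos f g by (simp add: algebra_simps)
  finally show ?thesis by (rule sym)
qed

text \<open>
  Since the potential is real, conjugation turns a Jost solution at \<open>k\<close> into one at \<open>- cnj k\<close>, which
  is \<open>- k\<close> for real \<open>k\<close>.
\<close>

lemma jost_solution_cnj:
  assumes "a > 0" "jost_solution a V k f"
  shows "jost_solution a V (- cnj k) (\<lambda>y. cnj (f y))"
proof -
  have sol: "schroedinger_solution V k f"
    using assms(2) by (simp add: jost_solution_def)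
  have "half_line_deriv (\<lambda>y. cnj (f y)) y = cnj (half_line_deriv f y)" if "y \<ge> a" for y
    using half_line_deriv_cnj[OF sol] that \<open>a > 0\<close> by simp
  then show ?thesis
    using assms(2) schroedinger_solution_cnj[OF sol]
    by (simp add: jost_solution_def exp_cnj)
qed

section \<open>The function \<open>D\<close> in terms of the Jost solution\<close>

theorem theorem5p2:
  fixes a :: real and V :: "real \<Rightarrow> real" and \<phi> f :: "complex \<Rightarrow> real \<Rightarrow> complex"
  assumes "a > 0"
    and "admissible_potential a V"
    and "\<forall>k. regular_solution V k (\<phi> k)"
    and "\<forall>k. jost_solution a V k (f k)"
  shows "(\<forall>k. k \<noteq> 0 \<longrightarrow> D_tilde a \<phi> k = (f k 0 - f (- k) 0) / (2 * \<i> * k)) \<and>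
         ((\<lambda>k. (f k 0 - f (- k) 0) / (2 * \<i> * k)) \<longlongrightarrow> D_tilde a \<phi> 0) (at 0) \<and>
         (\<forall>k::real. complex_of_real (Im (f (of_real k) 0)) = of_real k * D_tilde a \<phi> (of_real k))"
proof (intro conjI allI impI)
  have diff: "f k 0 - f (- k) 0 = 2 * \<i> * k * D_tilde a \<phi> k" for k
    using assms by (intro jost_solution_difference_at_0[of a V]) auto
  then show quot: "D_tilde a \<phi> k = (f k 0 - f (- k) 0) / (2 * \<i> * k)" if "k \<noteq> 0" for k
    using that by simp
  have "(D_tilde a \<phi> \<longlongrightarrow> D_tilde a \<phi> 0) (at 0)"
    using assms by (intro D_tilde_tendsto_at_0[of a V]) auto
  then show "((\<lambda>k. (f k 0 - f (- k) 0) / (2 * \<i> * k)) \<longlongrightarrow> D_tilde a \<phi> 0) (at 0)"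
    by (rule tendsto_cong[THEN iffD1, rotated])
      (auto simp: quot eventually_at intro!: exI[of _ 1])
  fix k :: real
  have "jost_solution a V (- of_real k) (\<lambda>y. cnj (f (of_real k) y))"
    using jost_solution_cnj[of a V "of_real k"] assms by simp
  then have "f (of_real k) 0 - cnj (f (of_real k) 0) = 2 * \<i> * of_real k * D_tilde a \<phi> (of_real k)"
    using assms by (intro jost_solution_difference_at_0[of a V _ _ _ "\<lambda>y. cnj (f (of_real k) y)"]) auto
  then show "complex_of_real (Im (f (of_real k) 0)) = of_real k * D_tilde a \<phi> (of_real k)"
    by (simp add: complex_diff_cnj)
qed

end
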